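(* Let $T>0$, $I=[0,T]$, let $\mathcal{H}_1,\mathcal{H}_2$ be real Hilbert spaces, let $\Omega\subset\mathcal{H}_2$ be nonempty, closed and convex, let $K:\Omega\to 2^{\Omega}$ be a set-valued mapping with nonempty closed convex values, and let $G:I\times\mathcal{H}_1\times\Omega\to\mathcal{H}_2$. Assume: (1) there are constants $l_G,\eta_G>0$ such that $\|G(s_2,x_2,u_2)-G(s_1,x_1,u_1)\|\le l_G(|s_2-s_1|+\|x_2-x_1\|+\|u_2-u_1\|)$ for all $s_1,s_2\in I$, $x_1,x_2\in\mathcal{H}_1$, $u_1,u_2\in\Omega$, and, for all $s\in I$, $x\in\mathcal{H}_1$, $u\in\Omega$ and $u_1,u_2\in K(u)$, $$\langle G(s,x,u_2),u_1-u_2\rangle\ge 0\ \Rightarrow\ \langle G(s,x,u_1),u_1-u_2\rangle\ge\eta_G\|u_1-u_2\|^2;$$ (2) there is a constant $l_K\ge 0$ such that $\|P_{K(u_2)}[\varpi]-P_{K(u_1)}[\varpi]\|\le l_K\|u_2-u_1\|$ for all $u_1,u_2\in\Omega$ and $\varpi\in\mathcal{H}_2$; (3) $2l_K^2\left(l_G\sqrt{l_G^2+\eta_G^2}+l_G^2+\eta_G^2\right)<\eta_G^2$. Then for each fixed $s\in I$ and $x\in C(I,\mathcal{H}_1)$ there exists a unique $u(s)\in K(u(s))\subset\Omega$ such that $$\langle G(s,x(s),u(s)),v-u(s)\rangle\ge 0\quad\text{for all } v\in K(u(s)).$$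
   Context: $P_{C}$ denotes the metric projection of a real Hilbert space onto a nonempty closed convex subset $C$. $C(I,\mathcal{H}_1)$ is the space of continuous functions $I\to\mathcal{H}_1$. *)

theory Defs
  imports "HOL-Analysis.Analysis"
begin

(* The library's closest_point requires a Heine-Borel, hence finite-dimensional, space.
   In a Hilbert space (real_inner together with complete_space) the minimizer of the distance
   exists and is unique for every nonempty closed convex C; for other C the value is unspecified. *)
definition metric_proj :: "'a::{real_inner,complete_space} set \<Rightarrow> 'a \<Rightarrow> 'a"
  where "metric_proj C z = (SOME p. p \<in> C \<and> (\<forall>y\<in>C. dist z p \<le> dist z y))"

end

theory Submission
  imports Defs
begin

text \<open>
  Fix \<open>s\<close> and \<open>x\<close> and write \<open>F = G s (x s)\<close>. A solution of the quasi-variational inequality is a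
  fixed point of the map that sends \<open>u\<close> to the solution \<open>Z u\<close> of the ordinary variational inequality
  for \<open>F\<close> over the fixed set \<open>K u\<close>. Two things are needed: that \<open>Z\<close> is defined, and
  that it is a contraction, after which Banach's theorem applies.

  Solvability over a closed convex set \<open>C\<close> (\<open>strongly_pseudomonotone_VI_solvable\<close>) is proved without
  a topological fixed point theorem. Strong pseudomonotonicity forces a solution \<open>x\<close> to satisfy
  \<open>inner (F y) (y - x) \<ge> \<eta> * (norm (y - x))\<^sup>2\<close> for every \<open>y \<in> C\<close>; for fixed \<open>y\<close> this
  says that \<open>x\<close> lies in a certain closed ball \<open>B y\<close>. Conversely, by continuity of \<open>F\<close> and Minty's argument along segments,
  every point of \<open>C\<close> that lies in all these balls is a solution. The convex hull of a
  finite \<open>S \<subseteq> C\<close> is covered by the balls \<open>B y\<close>, \<open>y \<in> S\<close>, which is the KKM condition.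
  Since the balls are convex, the conclusion of the KKM lemma follows from the Klee-Berge
  intersection theorem, an induction based on hyperplane separation
  (\<open>Klee_Berge\<close>, \<open>KKM_closed_convex\<close>). So finitely many of the sets \<open>C \<inter> B y\<close> always meet, and
  weak compactness, in the form of \<open>Inter_closed_convex_bounded_nonempty\<close>, makes all of them meet.

  The contraction estimate (\<open>VI_solution_stable\<close>) compares the solutions \<open>z\<^sub>1\<close>, \<open>z\<^sub>2\<close> over
  \<open>C\<^sub>1 = K u\<^sub>1\<close> and \<open>C\<^sub>2 = K u\<^sub>2\<close>. The point \<open>z\<^sub>1\<close> is the projection of \<open>z\<^sub>1 - F z\<^sub>1 / \<epsilon>\<close> onto \<open>C\<^sub>1\<close>; projecting the same
  vector onto \<open>C\<^sub>2\<close> moves the result by at most \<open>\<delta> = l\<^sub>K * norm (u\<^sub>2 - u\<^sub>1)\<close> and gives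
  an approximate solution over \<open>C\<^sub>2\<close>. Strong pseudomonotonicity on \<open>C\<^sub>2\<close> bounds its distance to
  \<open>z\<^sub>2\<close> by \<open>(l\<^sub>G + \<epsilon>) * \<delta> / \<eta>\<^sub>G\<close>. Because the projections are controlled at all vectors,
  \<open>\<epsilon>\<close> may tend to 0, and \<open>Z\<close> has Lipschitz constant \<open>(l\<^sub>G + \<eta>\<^sub>G) * l\<^sub>K / \<eta>\<^sub>G\<close>. The smallness
  condition makes this less than 1, since
  \<open>(l\<^sub>G + \<eta>\<^sub>G)\<^sup>2 \<le> 2 * (l\<^sub>G * sqrt (l\<^sub>G\<^sup>2 + \<eta>\<^sub>G\<^sup>2) + l\<^sub>G\<^sup>2 + \<eta>\<^sub>G\<^sup>2)\<close>.
\<close>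

section \<open>Intersections of closed convex sets in Hilbert space, and projections\<close>

text \<open>
  The parallelogram law, in the form that shows two nearly shortest vectors of a convex set to be
  close: their midpoint cannot be much shorter than either of them.
\<close>

lemma midpoint_norm_identity:
  fixes p q :: "'a::real_inner"
  shows "(norm (p - q))\<^sup>2 = 2 * (norm p)\<^sup>2 + 2 * (norm q)\<^sup>2 - 4 * (norm (midpoint p q))\<^sup>2"
  unfolding power2_norm_eq_inner midpoint_def
  by (simp add: inner_add inner_diff inner_commute algebra_simps)

text \<open>
  This is weak compactness of bounded closed convex sets, proved through norms alone. Among all
  finite subfamilies, let \<open>\<rho>\<close> be the supremum of the squared distance from the origin to their
  intersection. Along finite subfamilies for which this distance is nearly \<open>\<rho>\<close>, nearly shortest points
  form a Cauchy sequence by the parallelogram law. Adding one more set to these subfamilies cannot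
  push the distance beyond \<open>\<rho>\<close>, so the limit also belongs to that set.
\<close>

lemma Inter_closed_convex_bounded_nonempty:
  fixes M :: "'i \<Rightarrow> 'a::{real_inner,complete_space} set"
  assumes closed: "\<And>i. i \<in> I \<Longrightarrow> closed (M i)"
    and convex: "\<And>i. i \<in> I \<Longrightarrow> convex (M i)"
    and bounded: "j \<in> I" "bounded (M j)"
    and fip: "\<And>S. finite S \<Longrightarrow> S \<subseteq> I \<Longrightarrow> \<Inter> (M ` S) \<noteq> {}"
  shows "\<Inter> (M ` I) \<noteq> {}"
proof -
  \<comment> \<open>\<open>L\<close> consists of the lower bounds for the squared norm on some finite intersection.\<close>
  define L where "L = {a::real. \<exists>S. finite S \<and> S \<subseteq> I \<and> (\<forall>p\<in>\<Inter>(M ` S). a \<le> (norm p)\<^sup>2)}"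
  define \<rho> where "\<rho> = Sup L"
  define e where "e n = 1 / real (Suc n)" for n
  have e_pos: "e n > 0" for n by (simp add: e_def)
  have e_anti: "e n \<le> e m" if "m \<le> n" for m n
    using that by (simp add: e_def frac_le)
  have e_lim: "e \<longlonglongrightarrow> 0"
    unfolding e_def by (rule LIMSEQ_Suc[OF lim_1_over_n])
  obtain B where B: "\<And>p. p \<in> M j \<Longrightarrow> norm p \<le> B"
    using bounded(2) by (auto simp: bounded_iff)
  have L_le: "a \<le> B\<^sup>2" if a: "a \<in> L" for a
  proof -
    obtain S where S: "finite S" "S \<subseteq> I" "\<forall>p\<in>\<Inter>(M ` S). a \<le> (norm p)\<^sup>2"
      using a unfolding L_def by blast
    have "\<Inter> (M ` insert j S) \<noteq> {}" using S(1,2) bounded(1) by (intro fip) auto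
    then obtain p where "p \<in> \<Inter> (M ` insert j S)" by (meson ex_in_conv)
    then have "a \<le> (norm p)\<^sup>2" "norm p \<le> B" using S(3) B[of p] by auto
    then show ?thesis using power_mono[of "norm p" B 2] by simp
  qed
  have "0 \<in> L" unfolding L_def by (auto intro: exI[of _ "{}"])
  then have "L \<noteq> {}" by blast
  have "bdd_above L" using L_le by (rule bdd_aboveI)
  have far: "\<exists>S. finite S \<and> S \<subseteq> I \<and> (\<forall>p\<in>\<Inter>(M ` S). \<rho> - e n \<le> (norm p)\<^sup>2)" for n
  proof -
    have "\<rho> - e n < Sup L" using e_pos[of n] by (simp add: \<rho>_def)
    then obtain a where "a \<in> L" "\<rho> - e n < a"
      using less_cSupE[OF _ \<open>L \<noteq> {}\<close>] by blast
    then obtain S where "finite S" "S \<subseteq> I" "\<forall>p\<in>\<Inter>(M ` S). a \<le> (norm p)\<^sup>2"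
      unfolding L_def by blast
    then show ?thesis using \<open>\<rho> - e n < a\<close> by (intro exI[of _ S]) fastforce
  qed
  then obtain S where S: "\<And>n. finite (S n)" "\<And>n. S n \<subseteq> I"
      "\<And>n p. p \<in> \<Inter>(M ` S n) \<Longrightarrow> \<rho> - e n \<le> (norm p)\<^sup>2"
    by metis
  have near: "\<exists>p. p \<in> \<Inter>(M ` R) \<and> (norm p)\<^sup>2 \<le> \<rho> + e n" if "finite R" "R \<subseteq> I" for R n
  proof (rule ccontr)
    assume "\<not> ?thesis"
    then have "\<forall>p\<in>\<Inter>(M ` R). \<rho> + e n \<le> (norm p)\<^sup>2" by (meson less_imp_le not_le)
    then have "\<rho> + e n \<in> L" unfolding L_def using that by blast
    then have "\<rho> + e n \<le> \<rho>" unfolding \<rho>_def using \<open>bdd_above L\<close> by (rule cSup_upper)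
    then show False using e_pos[of n] by simp
  qed
  \<comment> \<open>Unions make the subfamilies increasing, so later points can be compared with earlier ones.\<close>
  define R where "R n = (\<Union>k\<le>n. S k)" for n
  have R: "finite (R n)" "R n \<subseteq> I" "S n \<subseteq> R n" for n
    unfolding R_def using S(1,2) by auto
  have R_mono: "R m \<subseteq> R n" if "m \<le> n" for m n
    unfolding R_def using that by (intro UN_mono) auto
  have close: "(norm (p - q))\<^sup>2 \<le> 8 * e n"
    if pq: "p \<in> \<Inter>(M ` S n)" "q \<in> \<Inter>(M ` S n)" "(norm p)\<^sup>2 \<le> \<rho> + e n" "(norm q)\<^sup>2 \<le> \<rho> + e n"
    for p q n
  proof -
    have "convex (\<Inter>(M ` S n))" using convex S(2) by (intro convex_INT) auto
    then have "midpoint p q \<in> \<Inter>(M ` S n)"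
      by (rule subsetD[OF closed_segment_subset[OF pq(1,2)] midpoint_in_closed_segment])
    then have "\<rho> - e n \<le> (norm (midpoint p q))\<^sup>2" by (rule S(3))
    then show ?thesis using pq(3,4) unfolding midpoint_norm_identity[of p q] by linarith
  qed
  have "\<forall>n. \<exists>p. p \<in> \<Inter>(M ` R n) \<and> (norm p)\<^sup>2 \<le> \<rho> + e n"
    by (intro allI near R(1,2))
  then obtain p where p: "\<And>n. p n \<in> \<Inter>(M ` R n)" "\<And>n. (norm (p n))\<^sup>2 \<le> \<rho> + e n"
    by metis
  have tail: "(norm (p m - p n))\<^sup>2 \<le> 8 * e n" if "n \<le> m" for m n
  proof (rule close)
    show "p m \<in> \<Inter>(M ` S n)" using p(1)[of m] subset_trans[OF R(3)[of n] R_mono[OF that]] by (auto simp: subset_iff)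
    show "p n \<in> \<Inter>(M ` S n)" using p(1)[of n] R(3)[of n] by (auto simp: subset_iff)
    show "(norm (p m))\<^sup>2 \<le> \<rho> + e n" using p(2)[of m] e_anti[OF that] by linarith
  qed (rule p(2))
  have "Cauchy p"
  proof (rule metric_CauchyI)
    fix d :: real assume "0 < d"
    then have "eventually (\<lambda>n. e n < (d/2)\<^sup>2 / 8) sequentially"
      by (intro order_tendstoD(2)[OF e_lim]) simp
    then obtain N where N: "e N < (d/2)\<^sup>2 / 8"
      using eventually_happens'[OF sequentially_bot] by blast
    have *: "dist (p m) (p N) < d / 2" if "m \<ge> N" for m
    proof -
      have "(norm (p m - p N))\<^sup>2 < (d/2)\<^sup>2"
        using tail[OF that] N by linarith
      then have "norm (p m - p N) < d/2"
        by (rule power2_less_imp_less) (use \<open>0 < d\<close> in simp)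
      then show ?thesis by (simp add: dist_norm)
    qed
    show "\<exists>N. \<forall>m\<ge>N. \<forall>n\<ge>N. dist (p m) (p n) < d"
      by (intro exI[of _ N] allI impI) (rule dist_triangle_half_l[OF * *])
  qed
  then obtain x where x: "p \<longlonglongrightarrow> x" by (meson Cauchy_convergent convergent_def)
  \<comment> \<open>Nearly shortest points \<open>q n\<close> that lie in \<open>M i\<close> as well must follow the sequence \<open>p\<close>.\<close>
  have "x \<in> M i" if "i \<in> I" for i
  proof -
    have "\<forall>n. \<exists>q. q \<in> \<Inter>(M ` insert i (R n)) \<and> (norm q)\<^sup>2 \<le> \<rho> + e n"
      using R(1,2) that by (intro allI near) auto
    then obtain q where q: "\<And>n. q n \<in> \<Inter>(M ` insert i (R n))" "\<And>n. (norm (q n))\<^sup>2 \<le> \<rho> + e n"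
      by metis
    have "(norm (q n - p n))\<^sup>2 \<le> 8 * e n" for n
    proof (rule close)
      show "q n \<in> \<Inter>(M ` S n)" using q(1)[of n] R(3)[of n] by (auto simp: subset_iff)
      show "p n \<in> \<Inter>(M ` S n)" using p(1)[of n] R(3)[of n] by (auto simp: subset_iff)
      show "(norm (q n))\<^sup>2 \<le> \<rho> + e n" by (rule q(2))
      show "(norm (p n))\<^sup>2 \<le> \<rho> + e n" by (rule p(2))
    qed
    then have "(\<lambda>n. (norm (q n - p n))\<^sup>2) \<longlonglongrightarrow> 0"
      by (intro tendsto_sandwich[OF always_eventually always_eventually tendsto_const
            tendsto_mult_right_zero[OF e_lim, of 8]]) simp_all
    then have "(\<lambda>n. sqrt ((norm (q n - p n))\<^sup>2)) \<longlonglongrightarrow> sqrt 0" by (rule tendsto_real_sqrt)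
    then have "(\<lambda>n. q n - p n) \<longlonglongrightarrow> 0" by (simp add: tendsto_norm_zero_iff)
    then have "(\<lambda>n. (q n - p n) + p n) \<longlonglongrightarrow> 0 + x" using x by (rule tendsto_add)
    then have "q \<longlonglongrightarrow> x" by simp
    then show ?thesis
      using closed_sequentially[OF closed[OF that], of q] q(1) by auto
  qed
  then show ?thesis by blast
qed

text \<open>
  The nearest points of \<open>C\<close> form the intersection of the sets \<open>C \<inter> cball z (dist z y)\<close> over
  \<open>y \<in> C\<close>; any finitely many of them contain the nearest of the finitely many \<open>y\<close>.
\<close>

lemma nearest_point_exists:
  fixes C :: "'a::{real_inner,complete_space} set"
  assumes "closed C" "convex C" "C \<noteq> {}"
  shows "\<exists>p\<in>C. \<forall>y\<in>C. dist z p \<le> dist z y"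
proof -
  obtain c where "c \<in> C" using assms(3) by blast
  have "\<Inter> ((\<lambda>y. C \<inter> cball z (dist z y)) ` C) \<noteq> {}"
  proof (rule Inter_closed_convex_bounded_nonempty)
    fix S assume S: "finite S" "S \<subseteq> C"
    show "\<Inter> ((\<lambda>y. C \<inter> cball z (dist z y)) ` S) \<noteq> {}"
    proof (cases "S = {}")
      case False
      then obtain y where "y \<in> S" "\<forall>y'\<in>S. dist z y \<le> dist z y'"
        using S(1) arg_min_if_finite[of S "dist z"] by (metis not_less)
      then show ?thesis using S(2) by auto
    qed simp
  qed (use assms \<open>c \<in> C\<close> in \<open>auto intro: convex_Int\<close>)
  then obtain p where "\<forall>y\<in>C. p \<in> C \<inter> cball z (dist z y)" by blast
  then show ?thesis using \<open>c \<in> C\<close> by (intro bexI[of _ p]) auto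
qed

lemma
  fixes C :: "'a::{real_inner,complete_space} set"
  assumes "closed C" "convex C" "C \<noteq> {}"
  shows metric_proj_in: "metric_proj C z \<in> C"
    and metric_proj_obtuse_angle: "y \<in> C \<Longrightarrow> inner (z - metric_proj C z) (y - metric_proj C z) \<le> 0"
proof -
  have *: "metric_proj C z \<in> C \<and> (\<forall>y\<in>C. dist z (metric_proj C z) \<le> dist z y)"
    unfolding metric_proj_def
    by (rule someI_ex) (use nearest_point_exists[OF assms, of z] in \<open>simp only: Bex_def\<close>)
  then show "metric_proj C z \<in> C" ..
  show "inner (z - metric_proj C z) (y - metric_proj C z) \<le> 0" if "y \<in> C"
    using * by (intro any_closest_point_dot[OF assms(2,1) _ that]) simp_all
qed

lemma metric_proj_eqI:
  fixes C :: "'a::{real_inner,complete_space} set"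
  assumes "closed C" "convex C" "p \<in> C" and "\<And>y. y \<in> C \<Longrightarrow> inner (z - p) (y - p) \<le> 0"
  shows "metric_proj C z = p"
proof -
  define q where "q = metric_proj C z"
  have ne: "C \<noteq> {}" using assms(3) by blast
  have "inner (z - p) (q - p) \<le> 0" "inner (z - q) (p - q) \<le> 0"
    unfolding q_def
    by (intro assms(4) metric_proj_in metric_proj_obtuse_angle assms(1-3) ne)+
  moreover have "inner (q - p) (q - p) = inner (z - p) (q - p) + inner (z - q) (p - q)"
    by (simp add: inner_diff_left inner_diff_right inner_commute)
  ultimately have "inner (q - p) (q - p) = 0"
    using inner_ge_zero[of "q - p"] by linarith
  then have "q = p" by (simp only: inner_eq_zero_iff right_minus_eq)
  then show ?thesis by (simp only: q_def)
qed

section \<open>The Klee-Berge theorem and the KKM lemma for convex sets\<close>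

text \<open>
  Dimension is unrestricted here: compactness provides a pair of nearest points, and the hyperplane
  that bisects the segment between them separates.
\<close>

lemma separate_compact_convex:
  fixes D E :: "'a::real_inner set"
  assumes "compact D" "convex D" "D \<noteq> {}" "compact E" "convex E" "E \<noteq> {}" "D \<inter> E = {}"
  shows "\<exists>a b. (\<forall>x\<in>D. inner a x < b) \<and> (\<forall>x\<in>E. b < inner a x)"
proof -
  have "compact (D \<times> E)" "D \<times> E \<noteq> {}" using assms by (auto intro: compact_Times)
  moreover have "continuous_on (D \<times> E) (\<lambda>z. dist (fst z) (snd z))"
    by (intro continuous_intros)
  ultimately obtain z where z: "z \<in> D \<times> E"
      "\<forall>w\<in>D \<times> E. dist (fst z) (snd z) \<le> dist (fst w) (snd w)"
    using continuous_attains_inf by blast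
  obtain d e where [simp]: "z = (d, e)" by (cases z)
  have de: "d \<in> D" "e \<in> E" using z(1) by auto
  have D: "inner (e - d) (x - d) \<le> 0" if "x \<in> D" for x
    using any_closest_point_dot[OF assms(2) compact_imp_closed[OF assms(1)] de(1) that, of e] z(2) de
    by (auto simp: dist_commute)
  have E: "inner (d - e) (x - e) \<le> 0" if "x \<in> E" for x
    using any_closest_point_dot[OF assms(5) compact_imp_closed[OF assms(4)] de(2) that, of d] z(2) de
    by auto
  have "e - d \<noteq> 0" using de assms(7) by auto
  then have "inner (e - d) (e - d) > 0" by simp
  then have gap: "inner (e - d) d < inner (e - d) e" by (simp add: inner_diff_right)
  let ?b = "inner (e - d) d / 2 + inner (e - d) e / 2"
  show ?thesis
  proof (intro exI conjI ballI)
    show "inner (e - d) x < ?b" if "x \<in> D" for x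
      using D[OF that] gap unfolding inner_diff_right by linarith
    show "?b < inner (e - d) x" if "x \<in> E" for x
    proof -
      have "inner (- (e - d)) (x - e) \<le> 0" using E[OF that] by (simp only: minus_diff_eq)
      then show ?thesis using gap unfolding inner_minus_left inner_diff_right by linarith
    qed
  qed
qed

text \<open>
  If all sets but \<open>A n\<close> meet in \<open>D\<close> and \<open>D\<close> misses \<open>A n\<close>, separate the two by a hyperplane \<open>H\<close>. The
  traces on \<open>H\<close> of the sets other than \<open>A n\<close> satisfy the hypotheses again: their union is \<open>H\<close> cut
  with the whole union, because \<open>A n\<close> does not reach \<open>H\<close>; and if one of them is omitted, the
  intersection of the others contains points of \<open>D\<close> and of \<open>A n\<close>, hence crosses \<open>H\<close>. By induction
  the traces meet, so \<open>D\<close> reaches \<open>H\<close>, a contradiction.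
\<close>

theorem Klee_Berge:
  fixes A :: "'i \<Rightarrow> 'a::real_inner set"
  assumes "finite I" and "\<And>i. i \<in> I \<Longrightarrow> compact (A i)" and "\<And>i. i \<in> I \<Longrightarrow> convex (A i)"
    and "convex (\<Union>(A ` I))" and "\<Union>(A ` I) \<noteq> {}"
    and "\<And>j. j \<in> I \<Longrightarrow> \<Inter>(A ` (I - {j})) \<noteq> {}"
  shows "\<Inter>(A ` I) \<noteq> {}"
  using assms
proof (induction I arbitrary: A rule: finite_induct)
  case (insert n I)
  show ?case
  proof (cases "I = {}")
    case True
    then show ?thesis using insert.prems(4) by simp
  next
    case False
    then obtain j where "j \<in> I" by blast
    define D where "D = \<Inter>(A ` I)"
    have "D \<noteq> {}" using insert.prems(5)[of n] insert.hyps(2) by (simp add: D_def)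
    have "A n \<noteq> {}" using insert.prems(5)[of j] insert.hyps(2) \<open>j \<in> I\<close> by auto
    have "compact D"
    proof -
      have "closed D" unfolding D_def
        using insert.prems(1) by (intro closed_INT) (auto intro: compact_imp_closed)
      then have "compact (A j \<inter> D)" using insert.prems(1) \<open>j \<in> I\<close> by (intro compact_Int_closed) auto
      moreover have "A j \<inter> D = D" using \<open>j \<in> I\<close> unfolding D_def by blast
      ultimately show ?thesis by simp
    qed
    have "convex D" unfolding D_def using insert.prems(2) by (intro convex_INT) auto
    show ?thesis
    proof
      assume empty: "\<Inter>(A ` insert n I) = {}"
      then have "D \<inter> A n = {}" unfolding D_def by auto
      then obtain a b where below: "\<And>x. x \<in> D \<Longrightarrow> inner a x < b"
          and above: "\<And>x. x \<in> A n \<Longrightarrow> b < inner a x"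
        using separate_compact_convex[OF \<open>compact D\<close> \<open>convex D\<close> \<open>D \<noteq> {}\<close>, of "A n"]
          insert.prems(1,2) \<open>A n \<noteq> {}\<close> by blast
      define H where "H = {x. inner a x = b}"
      have crosses: "C \<inter> H \<noteq> {}" if "convex C" "d \<in> C" "d \<in> D" "e \<in> C" "e \<in> A n" for C d e
        using connected_ivt_hyperplane[of C d e a b] that below[of d] above[of e]
        unfolding H_def by (force simp: convex_connected)
      have union: "\<Union>((\<lambda>i. A i \<inter> H) ` I) = \<Union>(A ` insert n I) \<inter> H"
        using above unfolding H_def by force
      have "\<Inter>((\<lambda>i. A i \<inter> H) ` I) \<noteq> {}"
      proof (rule insert.IH)
        show "compact (A i \<inter> H)" "convex (A i \<inter> H)" if "i \<in> I" for i
          using insert.prems(1,2) that unfolding H_def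
          by (auto intro: compact_Int_closed closed_hyperplane convex_Int convex_hyperplane)
        show "convex (\<Union>((\<lambda>i. A i \<inter> H) ` I))"
          unfolding union unfolding H_def by (intro convex_Int insert.prems convex_hyperplane)
        obtain d e where "d \<in> D" "e \<in> A n" using \<open>D \<noteq> {}\<close> \<open>A n \<noteq> {}\<close> by blast
        then show "\<Union>((\<lambda>i. A i \<inter> H) ` I) \<noteq> {}"
          using crosses[OF insert.prems(3), of d e] \<open>j \<in> I\<close> unfolding union D_def by blast
        show "\<Inter>((\<lambda>i. A i \<inter> H) ` (I - {k})) \<noteq> {}" if k: "k \<in> I" for k
        proof -
          have "k \<noteq> n" using k insert.hyps(2) by blast
          then obtain e where e: "e \<in> A n" "e \<in> \<Inter>(A ` (I - {k}))"
            using insert.prems(5)[of k] k by auto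
          moreover obtain d where "d \<in> D" using \<open>D \<noteq> {}\<close> by blast
          moreover have "convex (\<Inter>(A ` (I - {k})))"
            using insert.prems(2) by (intro convex_INT) auto
          ultimately have "\<Inter>(A ` (I - {k})) \<inter> H \<noteq> {}"
            by (intro crosses[of _ d e]) (auto simp: D_def)
          then show ?thesis by blast
        qed
      qed
      then obtain x where "x \<in> D" "x \<in> H" using \<open>j \<in> I\<close> unfolding D_def by blast
      then show False using below unfolding H_def by force
    qed
  qed
qed simp

text \<open>
  The covering condition for \<open>S = Y\<close> says that the traces on the hull of \<open>Y\<close> have a convex union, and
  induction on \<open>Y\<close> says that all traces but one meet. These are the hypotheses of \<open>Klee_Berge\<close>, so
  convexity of the sets replaces Sperner's lemma or Brouwer's theorem.
\<close>

corollary KKM_closed_convex: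
  fixes M :: "'a::real_inner \<Rightarrow> 'a set"
  assumes "finite Y" "Y \<noteq> {}"
    and "\<And>y. y \<in> Y \<Longrightarrow> closed (M y)" and "\<And>y. y \<in> Y \<Longrightarrow> convex (M y)"
    and "\<And>S. S \<subseteq> Y \<Longrightarrow> S \<noteq> {} \<Longrightarrow> convex hull S \<subseteq> \<Union>(M ` S)"
  shows "convex hull Y \<inter> \<Inter>(M ` Y) \<noteq> {}"
  using assms
proof (induction Y rule: finite_psubset_induct)
  case (psubset Y)
  define A where "A y = convex hull Y \<inter> M y" for y
  have "\<Inter>(A ` Y) \<noteq> {}"
  proof (rule Klee_Berge)
    have union: "\<Union>(A ` Y) = convex hull Y"
      using psubset.prems(4)[of Y] psubset.prems(1) unfolding A_def by blast
    show "convex (\<Union>(A ` Y))" unfolding union by (rule convex_convex_hull)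
    show "\<Union>(A ` Y) \<noteq> {}" unfolding union using psubset.prems(1) by simp
    show "compact (A y)" "convex (A y)" if "y \<in> Y" for y
      using psubset.prems(2,3) that psubset.hyps unfolding A_def
      by (auto intro: compact_Int_closed finite_imp_compact_convex_hull convex_Int)
    show "\<Inter>(A ` (Y - {y})) \<noteq> {}" if "y \<in> Y" for y
    proof (cases "Y - {y} = {}")
      case False
      have "convex hull (Y - {y}) \<inter> \<Inter>(M ` (Y - {y})) \<noteq> {}"
        using that False psubset.prems by (intro psubset.IH) auto
      moreover have "convex hull (Y - {y}) \<subseteq> convex hull Y" by (intro hull_mono) auto
      ultimately show ?thesis unfolding A_def by blast
    next
      case True
      show ?thesis unfolding True by simp
    qed
  qed (rule psubset.hyps)
  then show ?case using psubset.prems(1) unfolding A_def by blast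
qed

section \<open>Solvability of strongly pseudomonotone variational inequalities\<close>

definition solves_VI :: "('a::real_inner \<Rightarrow> 'a) \<Rightarrow> 'a set \<Rightarrow> 'a \<Rightarrow> bool"
  where "solves_VI F C z \<longleftrightarrow> z \<in> C \<and> (\<forall>v\<in>C. inner (F z) (v - z) \<ge> 0)"

definition strongly_pseudomonotone_on :: "real \<Rightarrow> 'a::real_inner set \<Rightarrow> ('a \<Rightarrow> 'a) \<Rightarrow> bool"
  where "strongly_pseudomonotone_on \<eta> C F \<longleftrightarrow>
    (\<forall>y\<in>C. \<forall>x\<in>C. inner (F y) (x - y) \<ge> 0 \<longrightarrow> inner (F x) (x - y) \<ge> \<eta> * (norm (x - y))\<^sup>2)"

text \<open>
  Completing the square in \<open>x\<close>. The ball form shows at once that the inequality cuts out a closed,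
  convex and bounded set of points \<open>x\<close>.
\<close>

lemma strong_Minty_inequality_iff_cball:
  fixes x y f :: "'a::real_inner"
  assumes "0 < \<eta>"
  shows "inner f (y - x) \<ge> \<eta> * (norm (y - x))\<^sup>2 \<longleftrightarrow>
    x \<in> cball (y - (1 / (2 * \<eta>)) *\<^sub>R f) (norm ((1 / (2 * \<eta>)) *\<^sub>R f))"
proof -
  define g where "g = (1 / (2 * \<eta>)) *\<^sub>R f"
  have f: "f = (2 * \<eta>) *\<^sub>R g" using assms by (simp add: g_def)
  have "inner f (y - x) \<ge> \<eta> * (norm (y - x))\<^sup>2 \<longleftrightarrow> (norm (y - x))\<^sup>2 \<le> 2 * inner g (y - x)"
    unfolding f using assms by (simp add: mult.assoc mult.left_commute)
  also have "\<dots> \<longleftrightarrow> (norm ((y - g) - x))\<^sup>2 \<le> (norm g)\<^sup>2"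
    unfolding power2_norm_eq_inner by (simp add: inner_diff inner_commute algebra_simps)
  also have "\<dots> \<longleftrightarrow> norm ((y - g) - x) \<le> norm g"
    by (simp add: abs_le_square_iff[symmetric])
  finally show ?thesis unfolding g_def by (simp only: mem_cball dist_norm)
qed

text \<open>
  Testing the hypothesis at points \<open>y\<close> of the segment from \<open>x\<close> to \<open>v\<close>, and dividing by the step length,
  gives \<open>inner (F y) (v - x) \<ge> 0\<close>; continuity of \<open>F\<close> transfers this to \<open>y = x\<close>.
\<close>

lemma Minty:
  assumes "convex C" "continuous_on C F" "x \<in> C"
    and minty: "\<And>y. y \<in> C \<Longrightarrow> inner (F y) (y - x) \<ge> 0"
  shows "solves_VI F C x"
proof -
  have "inner (F x) (v - x) \<ge> 0" if "v \<in> C" for v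
  proof -
    define t where "t n = 1 / real (Suc n)" for n
    define y where "y n = x + t n *\<^sub>R (v - x)" for n
    have "t \<longlonglongrightarrow> 0" unfolding t_def by (rule LIMSEQ_Suc[OF lim_1_over_n])
    have t: "0 < t n" "t n \<le> 1" for n by (auto simp: t_def)
    have yC: "y n \<in> C" for n
    proof -
      have "y n = (1 - t n) *\<^sub>R x + t n *\<^sub>R v" by (simp add: y_def algebra_simps)
      then show ?thesis using convexD_alt[OF assms(1,3) that, of "t n"] t[of n] by simp
    qed
    have "(\<lambda>n. x + t n *\<^sub>R (v - x)) \<longlonglongrightarrow> x + 0 *\<^sub>R (v - x)"
      using \<open>t \<longlonglongrightarrow> 0\<close> by (intro tendsto_intros)
    then have "y \<longlonglongrightarrow> x" by (simp add: y_def[abs_def])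
    then have "(\<lambda>n. F (y n)) \<longlonglongrightarrow> F x"
      by (rule continuous_on_tendsto_compose[OF assms(2) _ assms(3)]) (simp add: yC)
    then have "(\<lambda>n. inner (F (y n)) (v - x)) \<longlonglongrightarrow> inner (F x) (v - x)"
      by (intro tendsto_intros)
    moreover have "inner (F (y n)) (v - x) \<ge> 0" for n
    proof -
      have "t n * inner (F (y n)) (v - x) \<ge> 0" using minty[OF yC[of n]] by (simp add: y_def)
      then show ?thesis using t[of n] by (simp add: zero_le_mult_iff)
    qed
    ultimately show ?thesis using LIMSEQ_le_const by blast
  qed
  then show ?thesis using assms(3) unfolding solves_VI_def by blast
qed

text \<open>
  The balls of \<open>strong_Minty_inequality_iff_cball\<close> satisfy the covering condition of the KKM lemma:
  a point \<open>x\<close> of the hull of \<open>S\<close> has \<open>inner (F x) (y - x) \<ge> 0\<close> for some \<open>y \<in> S\<close>, as otherwise \<open>S\<close> and its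
  hull would lie in an open half-space that excludes \<open>x\<close>, and then pseudomonotonicity puts \<open>x\<close> into
  the ball of \<open>y\<close>.
\<close>

theorem strongly_pseudomonotone_VI_solvable:
  fixes F :: "'a::{real_inner,complete_space} \<Rightarrow> 'a"
  assumes C: "closed C" "convex C" "C \<noteq> {}"
    and "0 < \<eta>" and mono: "strongly_pseudomonotone_on \<eta> C F" and "continuous_on C F"
  shows "\<exists>z. solves_VI F C z"
proof -
  define B where "B y = cball (y - (1 / (2 * \<eta>)) *\<^sub>R F y) (norm ((1 / (2 * \<eta>)) *\<^sub>R F y))" for y
  have B: "x \<in> B y \<longleftrightarrow> inner (F y) (y - x) \<ge> \<eta> * (norm (y - x))\<^sup>2" for x y
    unfolding B_def strong_Minty_inequality_iff_cball[OF \<open>0 < \<eta>\<close>] ..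
  have B_closed_convex: "closed (B y)" "convex (B y)" "bounded (B y)" for y
    by (simp_all add: B_def)
  have cover: "convex hull S \<subseteq> \<Union>(B ` S)" if S: "finite S" "S \<subseteq> C" for S
  proof
    fix x assume x: "x \<in> convex hull S"
    then have "x \<in> C" using hull_minimal[of S C convex] S(2) C(2) by blast
    have "\<exists>y\<in>S. inner (F x) (y - x) \<ge> 0"
    proof (rule ccontr)
      assume "\<not> ?thesis"
      then have "S \<subseteq> {y. inner (F x) y < inner (F x) x}"
        by (auto simp: inner_diff_right not_le)
      then have "convex hull S \<subseteq> {y. inner (F x) y < inner (F x) x}"
        by (intro hull_minimal convex_halfspace_lt)
      then show False using x by blast
    qed
    then obtain y where "y \<in> S" "inner (F x) (y - x) \<ge> 0" by blast
    then have "x \<in> B y" unfolding B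
      using mono \<open>x \<in> C\<close> S(2) unfolding strongly_pseudomonotone_on_def by blast
    then show "x \<in> \<Union>(B ` S)" using \<open>y \<in> S\<close> by blast
  qed
  obtain c where "c \<in> C" using C(3) by blast
  have "\<Inter> ((\<lambda>y. C \<inter> B y) ` C) \<noteq> {}"
  proof (rule Inter_closed_convex_bounded_nonempty)
    show "bounded (C \<inter> B c)" using B_closed_convex(3) by (simp add: bounded_Int)
    fix S assume S: "finite S" "S \<subseteq> C"
    show "\<Inter> ((\<lambda>y. C \<inter> B y) ` S) \<noteq> {}"
    proof (cases "S = {}")
      case False
      have "convex hull S \<inter> \<Inter>(B ` S) \<noteq> {}"
      proof (rule KKM_closed_convex)
        show "convex hull R \<subseteq> \<Union>(B ` R)" if "R \<subseteq> S" for R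
          using that S by (intro cover) (auto intro: finite_subset)
      qed (use S(1) False B_closed_convex in auto)
      moreover have "convex hull S \<subseteq> C" using S(2) C(2) by (rule hull_minimal)
      ultimately show ?thesis by blast
    qed simp
  qed (use C \<open>c \<in> C\<close> B_closed_convex in \<open>auto intro: convex_Int\<close>)
  then obtain x where x: "\<And>y. y \<in> C \<Longrightarrow> x \<in> C \<inter> B y" by blast
  have "solves_VI F C x"
  proof (rule Minty)
    show "x \<in> C" using x[OF \<open>c \<in> C\<close>] by blast
    show "inner (F y) (y - x) \<ge> 0" if "y \<in> C" for y
    proof -
      have "\<eta> * (norm (y - x))\<^sup>2 \<ge> 0" using \<open>0 < \<eta>\<close> by simp
      moreover have "\<eta> * (norm (y - x))\<^sup>2 \<le> inner (F y) (y - x)"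
        using x[OF that] by (simp only: B Int_iff)
      ultimately show ?thesis by linarith
    qed
  qed (use assms in auto)
  then show ?thesis by blast
qed

section \<open>Dependence of the solution on the constraint set\<close>

text \<open>
  Controlling the two projections at the single vector \<open>z\<^sub>1 - F z\<^sub>1 / \<epsilon>\<close> already yields the estimate
  with \<open>l + \<epsilon>\<close> in place of \<open>l\<close>: the projection \<open>z\<close> of that vector onto \<open>C\<^sub>2\<close> is within \<open>\<delta>\<close> of \<open>z\<^sub>1\<close>, and
  the obtuse angle property at \<open>z\<close> bounds \<open>inner (F z\<^sub>1) (z - z\<^sub>2)\<close> by a multiple of \<open>\<epsilon>\<close>,
  however large \<open>F z\<^sub>1\<close> may be. Letting \<open>\<epsilon>\<close> tend to 0 removes the extra term.
\<close>

lemma VI_solution_stable: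
  fixes F :: "'a::{real_inner,complete_space} \<Rightarrow> 'a"
  assumes C1: "closed C\<^sub>1" "convex C\<^sub>1" and C2: "closed C\<^sub>2" "convex C\<^sub>2"
    and lip: "\<And>u v. u \<in> C\<^sub>1 \<union> C\<^sub>2 \<Longrightarrow> v \<in> C\<^sub>1 \<union> C\<^sub>2 \<Longrightarrow> norm (F u - F v) \<le> l * norm (u - v)"
    and "0 < \<eta>" "0 \<le> l" and mono: "strongly_pseudomonotone_on \<eta> C\<^sub>2 F"
    and sol: "solves_VI F C\<^sub>1 z\<^sub>1" "solves_VI F C\<^sub>2 z\<^sub>2"
    and \<delta>: "\<And>w. norm (metric_proj C\<^sub>2 w - metric_proj C\<^sub>1 w) \<le> \<delta>"
  shows "\<eta> * norm (z\<^sub>1 - z\<^sub>2) \<le> (l + \<eta>) * \<delta>"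
proof -
  have "0 \<le> \<delta>" using \<delta> norm_ge_zero by (rule order_trans[rotated])
  have bound: "\<eta> * norm (z\<^sub>1 - z\<^sub>2) \<le> (l + \<epsilon> + \<eta>) * \<delta>" if "0 < \<epsilon>" for \<epsilon>
  proof -
    define w where "w = z\<^sub>1 - (1 / \<epsilon>) *\<^sub>R F z\<^sub>1"
    define z where "z = metric_proj C\<^sub>2 w"
    have z12: "z\<^sub>1 \<in> C\<^sub>1" "z\<^sub>2 \<in> C\<^sub>2" using sol by (auto simp: solves_VI_def)
    then have "C\<^sub>2 \<noteq> {}" by blast
    have "metric_proj C\<^sub>1 w = z\<^sub>1"
      using sol(1) \<open>0 < \<epsilon>\<close> z12(1)
      by (intro metric_proj_eqI C1) (auto simp: w_def solves_VI_def)
    then have moved: "norm (z - z\<^sub>1) \<le> \<delta>" using \<delta>[of w] by (simp add: z_def)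
    have "z \<in> C\<^sub>2" unfolding z_def using C2 \<open>C\<^sub>2 \<noteq> {}\<close> by (rule metric_proj_in)
    have "inner (w - z) (z\<^sub>2 - z) \<le> 0"
      unfolding z_def by (rule metric_proj_obtuse_angle[OF C2 \<open>C\<^sub>2 \<noteq> {}\<close> z12(2)])
    moreover have "\<epsilon> *\<^sub>R (w - z) = \<epsilon> *\<^sub>R (z\<^sub>1 - z) - F z\<^sub>1"
      using \<open>0 < \<epsilon>\<close> by (simp add: w_def algebra_simps)
    ultimately have "inner (\<epsilon> *\<^sub>R (z\<^sub>1 - z) - F z\<^sub>1) (z\<^sub>2 - z) \<le> 0"
      using \<open>0 < \<epsilon>\<close> by (metis inner_scaleR_left mult_nonneg_nonpos less_imp_le)
    then have "inner (F z\<^sub>1) (z - z\<^sub>2) \<le> \<epsilon> * inner (z - z\<^sub>1) (z\<^sub>2 - z)"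
      by (simp add: inner_diff algebra_simps)
    also have "\<dots> \<le> \<epsilon> * (norm (z - z\<^sub>1) * norm (z\<^sub>2 - z))"
      using \<open>0 < \<epsilon>\<close> norm_cauchy_schwarz by (intro mult_left_mono) auto
    finally have inner_z1: "inner (F z\<^sub>1) (z - z\<^sub>2) \<le> \<epsilon> * norm (z - z\<^sub>1) * norm (z - z\<^sub>2)"
      by (simp add: norm_minus_commute)
    \<comment> \<open>The solution property of \<open>z\<^sub>2\<close>, tested at \<open>z\<close>, is the premise of pseudomonotonicity.\<close>
    have "\<eta> * (norm (z - z\<^sub>2))\<^sup>2 \<le> inner (F z) (z - z\<^sub>2)"
      using mono sol(2) \<open>z \<in> C\<^sub>2\<close> unfolding strongly_pseudomonotone_on_def solves_VI_def by blast
    also have "\<dots> = inner (F z - F z\<^sub>1) (z - z\<^sub>2) + inner (F z\<^sub>1) (z - z\<^sub>2)"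
      by (simp add: inner_diff_left)
    also have "\<dots> \<le> l * norm (z - z\<^sub>1) * norm (z - z\<^sub>2) + \<epsilon> * norm (z - z\<^sub>1) * norm (z - z\<^sub>2)"
    proof (rule add_mono[OF _ inner_z1])
      have "inner (F z - F z\<^sub>1) (z - z\<^sub>2) \<le> norm (F z - F z\<^sub>1) * norm (z - z\<^sub>2)"
        by (rule norm_cauchy_schwarz)
      also have "\<dots> \<le> l * norm (z - z\<^sub>1) * norm (z - z\<^sub>2)"
        using lip[of z z\<^sub>1] \<open>z \<in> C\<^sub>2\<close> z12 by (intro mult_right_mono) auto
      finally show "inner (F z - F z\<^sub>1) (z - z\<^sub>2) \<le> l * norm (z - z\<^sub>1) * norm (z - z\<^sub>2)" .
    qed
    finally have "norm (z - z\<^sub>2) * (\<eta> * norm (z - z\<^sub>2)) \<le> norm (z - z\<^sub>2) * ((l + \<epsilon>) * norm (z - z\<^sub>1))"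
      by (simp add: algebra_simps power2_eq_square)
    then have "\<eta> * norm (z - z\<^sub>2) \<le> (l + \<epsilon>) * norm (z - z\<^sub>1)"
      using \<open>0 \<le> l\<close> \<open>0 < \<epsilon>\<close> by (cases "z = z\<^sub>2") (auto simp: mult_le_cancel_left)
    moreover have "\<eta> * norm (z\<^sub>1 - z\<^sub>2) \<le> \<eta> * (norm (z - z\<^sub>1) + norm (z - z\<^sub>2))"
      using \<open>0 < \<eta>\<close> norm_triangle_ineq[of "z\<^sub>1 - z" "z - z\<^sub>2"]
      by (intro mult_left_mono) (auto simp: norm_minus_commute)
    ultimately have "\<eta> * norm (z\<^sub>1 - z\<^sub>2) \<le> (l + \<epsilon> + \<eta>) * norm (z - z\<^sub>1)"
      by (simp add: algebra_simps)
    also have "\<dots> \<le> (l + \<epsilon> + \<eta>) * \<delta>"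
      using moved \<open>0 \<le> l\<close> \<open>0 < \<epsilon>\<close> \<open>0 < \<eta>\<close> by (intro mult_left_mono) auto
    finally show ?thesis .
  qed
  have "((\<lambda>\<epsilon>. (l + \<epsilon> + \<eta>) * \<delta>) \<longlongrightarrow> (l + 0 + \<eta>) * \<delta>) (at_right 0)"
    by (intro tendsto_intros)
  moreover have "\<forall>\<^sub>F \<epsilon> in at_right 0. \<eta> * norm (z\<^sub>1 - z\<^sub>2) \<le> (l + \<epsilon> + \<eta>) * \<delta>"
    unfolding eventually_at_right_field using bound by (auto intro!: exI[of _ 1])
  ultimately have "\<eta> * norm (z\<^sub>1 - z\<^sub>2) \<le> (l + 0 + \<eta>) * \<delta>"
    by (intro tendsto_lowerbound) auto
  then show ?thesis by simp
qed

section \<open>The quasi-variational inequality\<close>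

text \<open>
  Expanding \<open>(l + \<eta>)\<^sup>2\<close> and using \<open>\<eta> \<le> sqrt (l\<^sup>2 + \<eta>\<^sup>2)\<close> in the mixed term shows that the hypothesis
  is stronger than \<open>((l + \<eta>) * k)\<^sup>2 < \<eta>\<^sup>2\<close>.
\<close>

lemma contraction_modulus_less_one:
  fixes l \<eta> k :: real
  assumes "0 < l" "0 < \<eta>"
    and "2 * k\<^sup>2 * (l * sqrt (l\<^sup>2 + \<eta>\<^sup>2) + l\<^sup>2 + \<eta>\<^sup>2) < \<eta>\<^sup>2"
  shows "(l + \<eta>) * k / \<eta> < 1"
proof -
  have "\<eta> \<le> sqrt (l\<^sup>2 + \<eta>\<^sup>2)" by (rule real_le_rsqrt) simp
  then have "l * \<eta> \<le> l * sqrt (l\<^sup>2 + \<eta>\<^sup>2)" using assms(1) by simp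
  then have "(l + \<eta>)\<^sup>2 \<le> 2 * (l * sqrt (l\<^sup>2 + \<eta>\<^sup>2) + l\<^sup>2 + \<eta>\<^sup>2)"
    unfolding power2_sum distrib_left mult.assoc using zero_le_power2[of l] zero_le_power2[of \<eta>] by linarith
  then have "k\<^sup>2 * (l + \<eta>)\<^sup>2 \<le> k\<^sup>2 * (2 * (l * sqrt (l\<^sup>2 + \<eta>\<^sup>2) + l\<^sup>2 + \<eta>\<^sup>2))"
    by (rule mult_left_mono) simp
  also have "\<dots> = 2 * k\<^sup>2 * (l * sqrt (l\<^sup>2 + \<eta>\<^sup>2) + l\<^sup>2 + \<eta>\<^sup>2)" by (simp only: mult_ac)
  also note assms(3)
  finally have "((l + \<eta>) * k)\<^sup>2 < \<eta>\<^sup>2" by (simp only: power_mult_distrib mult.commute)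
  then have "(l + \<eta>) * k < \<eta>" by (rule power2_less_imp_less) (use assms(2) in simp)
  then show ?thesis using assms(2) by simp
qed

text \<open>
  The stability estimate is used twice: for equal constraint sets it makes the solution \<open>Z u\<close> of
  the problem over \<open>K u\<close> unique, so that the solutions of the quasi-variational inequality are exactly the
  fixed points of \<open>Z\<close>; for different ones it makes \<open>Z\<close> a contraction.
\<close>

theorem quasi_VI_unique_solution:
  fixes F :: "'a::{real_inner,complete_space} \<Rightarrow> 'a" and K :: "'a \<Rightarrow> 'a set"
  assumes \<Omega>: "closed \<Omega>" "\<Omega> \<noteq> {}"
    and K: "\<And>u. u \<in> \<Omega> \<Longrightarrow> K u \<subseteq> \<Omega> \<and> K u \<noteq> {} \<and> closed (K u) \<and> convex (K u)"
    and lip: "\<And>u v. u \<in> \<Omega> \<Longrightarrow> v \<in> \<Omega> \<Longrightarrow> norm (F u - F v) \<le> l * norm (u - v)"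
    and mono: "\<And>u. u \<in> \<Omega> \<Longrightarrow> strongly_pseudomonotone_on \<eta> (K u) F"
    and pos: "0 < \<eta>" "0 \<le> l" "0 \<le> k" and small: "(l + \<eta>) * k / \<eta> < 1"
    and proj: "\<And>u v w. u \<in> \<Omega> \<Longrightarrow> v \<in> \<Omega> \<Longrightarrow>
      norm (metric_proj (K v) w - metric_proj (K u) w) \<le> k * norm (v - u)"
  shows "\<exists>!u. u \<in> \<Omega> \<and> solves_VI F (K u) u"
proof -
  have stable: "norm (z\<^sub>1 - z\<^sub>2) \<le> (l + \<eta>) * k / \<eta> * norm (u\<^sub>1 - u\<^sub>2)"
    if "u\<^sub>1 \<in> \<Omega>" "u\<^sub>2 \<in> \<Omega>" "solves_VI F (K u\<^sub>1) z\<^sub>1" "solves_VI F (K u\<^sub>2) z\<^sub>2" for u\<^sub>1 u\<^sub>2 z\<^sub>1 z\<^sub>2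
  proof -
    have "\<eta> * norm (z\<^sub>1 - z\<^sub>2) \<le> (l + \<eta>) * (k * norm (u\<^sub>2 - u\<^sub>1))"
    proof (rule VI_solution_stable)
      show "norm (F u - F v) \<le> l * norm (u - v)" if "u \<in> K u\<^sub>1 \<union> K u\<^sub>2" "v \<in> K u\<^sub>1 \<union> K u\<^sub>2" for u v
        using that K[OF \<open>u\<^sub>1 \<in> \<Omega>\<close>] K[OF \<open>u\<^sub>2 \<in> \<Omega>\<close>] by (intro lip) auto
    qed (use that K mono pos proj in auto)
    then show ?thesis using pos(1) by (simp add: field_simps norm_minus_commute)
  qed
  have "\<exists>z. solves_VI F (K u) z" if "u \<in> \<Omega>" for u
  proof (rule strongly_pseudomonotone_VI_solvable)
    have "l-lipschitz_on (K u) F"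
      using lip K[OF that] pos(2) by (intro lipschitz_onI) (auto simp: dist_norm)
    then show "continuous_on (K u) F" by (rule lipschitz_on_continuous_on)
  qed (use K[OF that] pos mono[OF that] in auto)
  then obtain Z where Z: "\<And>u. u \<in> \<Omega> \<Longrightarrow> solves_VI F (K u) (Z u)" by metis
  have fix_iff: "solves_VI F (K u) u \<longleftrightarrow> Z u = u" if "u \<in> \<Omega>" for u
    using stable[OF that that _ Z[OF that], of u] Z[OF that] by auto
  have "\<exists>!u\<in>\<Omega>. Z u = u"
  proof (rule Banach_fix)
    show "complete \<Omega>" using \<Omega>(1) by (simp add: complete_eq_closed)
    show "Z ` \<Omega> \<subseteq> \<Omega>" using Z K unfolding solves_VI_def by blast
    show "dist (Z u) (Z v) \<le> (l + \<eta>) * k / \<eta> * dist u v" if "u \<in> \<Omega>" "v \<in> \<Omega>" for u v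
      unfolding dist_norm using that Z by (intro stable) auto
  qed (use \<Omega> pos small in auto)
  then show ?thesis using fix_iff by (simp cong: conj_cong)
qed

theorem lemma3p1:
  fixes T :: real
    and \<Omega> :: "'h2::{real_inner,complete_space} set"
    and K :: "'h2 \<Rightarrow> 'h2 set"
    and G :: "real \<Rightarrow> 'h1::{real_inner,complete_space} \<Rightarrow> 'h2 \<Rightarrow> 'h2"
    and l\<^sub>G \<eta>\<^sub>G l\<^sub>K :: real
  assumes "0 < T"
    and "\<Omega> \<noteq> {}" and "closed \<Omega>" and "convex \<Omega>"
    and "\<And>u. u \<in> \<Omega> \<Longrightarrow> K u \<subseteq> \<Omega> \<and> K u \<noteq> {} \<and> closed (K u) \<and> convex (K u)"
    and "0 < l\<^sub>G" and "0 < \<eta>\<^sub>G"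
    and "\<And>s\<^sub>1 s\<^sub>2 x\<^sub>1 x\<^sub>2 u\<^sub>1 u\<^sub>2.
           \<lbrakk>s\<^sub>1 \<in> {0..T}; s\<^sub>2 \<in> {0..T}; u\<^sub>1 \<in> \<Omega>; u\<^sub>2 \<in> \<Omega>\<rbrakk> \<Longrightarrow>
           norm (G s\<^sub>2 x\<^sub>2 u\<^sub>2 - G s\<^sub>1 x\<^sub>1 u\<^sub>1)
             \<le> l\<^sub>G * (\<bar>s\<^sub>2 - s\<^sub>1\<bar> + norm (x\<^sub>2 - x\<^sub>1) + norm (u\<^sub>2 - u\<^sub>1))"
    and "\<And>s x u u\<^sub>1 u\<^sub>2.
           \<lbrakk>s \<in> {0..T}; u \<in> \<Omega>; u\<^sub>1 \<in> K u; u\<^sub>2 \<in> K u; inner (G s x u\<^sub>2) (u\<^sub>1 - u\<^sub>2) \<ge> 0\<rbrakk> \<Longrightarrow>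
           inner (G s x u\<^sub>1) (u\<^sub>1 - u\<^sub>2) \<ge> \<eta>\<^sub>G * (norm (u\<^sub>1 - u\<^sub>2))\<^sup>2"
    and "0 \<le> l\<^sub>K"
    and "\<And>u\<^sub>1 u\<^sub>2 w. \<lbrakk>u\<^sub>1 \<in> \<Omega>; u\<^sub>2 \<in> \<Omega>\<rbrakk> \<Longrightarrow>
           norm (metric_proj (K u\<^sub>2) w - metric_proj (K u\<^sub>1) w) \<le> l\<^sub>K * norm (u\<^sub>2 - u\<^sub>1)"
    and "2 * l\<^sub>K\<^sup>2 * (l\<^sub>G * sqrt (l\<^sub>G\<^sup>2 + \<eta>\<^sub>G\<^sup>2) + l\<^sub>G\<^sup>2 + \<eta>\<^sub>G\<^sup>2) < \<eta>\<^sub>G\<^sup>2"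
  shows "\<forall>s\<in>{0..T}. \<forall>x :: real \<Rightarrow> 'h1. continuous_on {0..T} x \<longrightarrow>
           (\<exists>!u. u \<in> \<Omega> \<and> u \<in> K u \<and> (\<forall>v\<in>K u. inner (G s (x s) u) (v - u) \<ge> 0))"
proof (intro ballI allI impI)
  fix s and x :: "real \<Rightarrow> 'h1" assume s: "s \<in> {0..T}"
  have "\<exists>!u. u \<in> \<Omega> \<and> solves_VI (G s (x s)) (K u) u"
  proof (rule quasi_VI_unique_solution)
    show "norm (G s (x s) u - G s (x s) v) \<le> l\<^sub>G * norm (u - v)" if "u \<in> \<Omega>" "v \<in> \<Omega>" for u v
      using assms(8)[of s s v u "x s" "x s"] s that by simp
    show "strongly_pseudomonotone_on \<eta>\<^sub>G (K u) (G s (x s))" if "u \<in> \<Omega>" for u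
      unfolding strongly_pseudomonotone_on_def using assms(9) s that by blast
    show "(l\<^sub>G + \<eta>\<^sub>G) * l\<^sub>K / \<eta>\<^sub>G < 1"
      using assms by (intro contraction_modulus_less_one) auto
  qed (use assms in auto)
  then show "\<exists>!u. u \<in> \<Omega> \<and> u \<in> K u \<and> (\<forall>v\<in>K u. inner (G s (x s) u) (v - u) \<ge> 0)"
    unfolding solves_VI_def .
qed

end
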